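(* Let $\mathbf{V}$ be a valuation domain, let $n \geq 1$ be an integer, and let $M$ be a finitely generated $\mathbf{V}[X]$-submodule of $\mathbf{V}[X]^n$. Then the $\mathbf{V}$-saturation of $M$ in $\mathbf{V}[X]^n$, i.e. $\{x \in \mathbf{V}[X]^n \mid \exists a \in \mathbf{V}\setminus\{0\},\ ax \in M\}$, is a finitely generated $\mathbf{V}[X]$-module.
   Context: Rings are commutative with unit. A valuation domain is an integral domain $\mathbf{V}$ such that for all $a,b\in\mathbf{V}$ either $a\mid b$ or $b\mid a$. (Constructively, one assumes that this disjunction is decided by an algorithm which also produces the quotient, that equality to $0$ in $\mathbf{V}$ is decidable, and that $\mathbf{V}$ is residually discrete, i.e. one can decide whether an element is a unit; in classical mathematics these conditions hold for every valuation domain.) *)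

theory Defs
  imports "HOL-Analysis.Finite_Cartesian_Product" "HOL-Computational_Algebra.Polynomial"
begin

class valuation_domain = idom +
  assumes dvd_linear: "a dvd b \<or> b dvd a"

definition fin_gen_submodule ::
    "('r::comm_ring_1 \<Rightarrow> 'm::ab_group_add \<Rightarrow> 'm) \<Rightarrow> 'm set \<Rightarrow> bool" where
  "fin_gen_submodule smul N \<longleftrightarrow>
     module.subspace smul N \<and> (\<exists>S. finite S \<and> N = module.span smul S)"

text \<open>A module over \<open>'a poly\<close> is an \<open>'a\<close>-module through the constant polynomials, so \<open>a\<close> acts on
  \<open>x\<close> as \<open>[:a:] *s x\<close>.\<close>

definition saturation ::
    "('a::idom poly ^ 'n) set \<Rightarrow> ('a poly ^ 'n) set" where
  "saturation M = {x. \<exists>a::'a. a \<noteq> 0 \<and> [:a:] *s x \<in> M}"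

text \<open>The locale constants \<open>module.subspace\<close> and \<open>module.span\<close> have their intended meaning here
  because the free module \<open>'r ^ 'n\<close> satisfies the module axioms.\<close>

lemma module_vector_scalar_mult:
  "module ((*s) :: 'r::comm_ring_1 \<Rightarrow> 'r ^ 'n \<Rightarrow> 'r ^ 'n)"
  by standard (simp_all add: vec_eq_iff algebra_simps)

end

theory Submission
  imports Defs
begin

text \<open>Any saturated submodule \<open>S\<close> of \<open>V[X]\<^sup>n\<close> is finitely generated, by a Groebner basis argument
  modulo the maximal ideal of \<open>V\<close>, run separately on each piece \<open>S\<^sub>D\<close> of elements of bounded degree.
  List the monomials of \<open>V[X]\<^sup>n\<close> as a sequence on which \<open>X\<close> acts as the shift by \<open>n\<close>. Let \<open>k\<close> be the
  residual leading position of \<open>f\<close> if the coefficient of \<open>f\<close> at \<open>k\<close> is a unit and all later ones are not. The pairs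
  formed by a bound \<open>D\<close> and a residual leading position of an element of \<open>S\<^sub>D\<close> are stable under
  increasing \<open>D\<close> and under the simultaneous shift by \<open>n\<close>, so by Dickson's lemma finitely many
  elements \<open>G\<close> of \<open>S\<close> account for all of them. Given \<open>f\<close> in \<open>S\<^sub>D\<close>, a linear system that is
  triangular with unit diagonal modulo the maximal ideal yields \<open>g\<close> in the span of \<open>G\<close>, within the
  bound \<open>D\<close>, which agrees with \<open>f\<close> at all residual leading positions of \<open>S\<^sub>D\<close>. If \<open>f - g\<close> were
  nonzero, then dividing it by its content would give an element of \<open>S\<^sub>D\<close> with a residual leading
  position at which it vanishes.\<close>

section \<open>Valuation domains\<close>

text \<open>One of \<open>a\<close> and \<open>b\<close> divides the other, hence the sum, so a unit
  sum would make it a unit. Thus the ring is local.\<close>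

lemma nonunit_add:
  fixes a b :: "'a::valuation_domain"
  assumes "\<not> a dvd 1" "\<not> b dvd 1"
  shows "\<not> (a + b) dvd 1"
  using dvd_linear[of a b] assms by (metis dvd_add dvd_refl dvd_trans)

lemma unit_diff_nonunit:
  fixes a b :: "'a::valuation_domain"
  assumes "a dvd 1" "\<not> b dvd 1"
  shows "(a - b) dvd 1"
  using nonunit_add[of "a - b" b] assms by auto

lemma finite_set_has_divisor:
  fixes A :: "'a::valuation_domain set"
  assumes "finite A" "A \<noteq> {}"
  shows "\<exists>c\<in>A. \<forall>x\<in>A. c dvd x"
  using assms
proof (induction rule: finite_ne_induct)
  case (singleton x)
  then show ?case by simp
next
  case (insert x F)
  then obtain c where c: "c \<in> F" "\<forall>y\<in>F. c dvd y" by blast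
  show ?case
  proof (cases "c dvd x")
    case True
    with c show ?thesis by auto
  next
    case False
    with dvd_linear have "x dvd c" by blast
    with c show ?thesis by (auto intro: dvd_trans)
  qed
qed

lemma triangular_solve:
  fixes N :: "(nat \<Rightarrow> 'a::valuation_domain) set"
  assumes "finite E"
    and "\<And>g h. g \<in> N \<Longrightarrow> h \<in> N \<Longrightarrow> (\<lambda>k. g k + h k) \<in> N"
    and "\<And>c g. g \<in> N \<Longrightarrow> (\<lambda>k. c * g k) \<in> N"
    and "(\<lambda>k. 0) \<in> N"
    and "\<And>m. m \<in> E \<Longrightarrow> \<exists>h\<in>N. h m dvd 1 \<and> (\<forall>m'>m. \<not> h m' dvd 1)"
  shows "\<exists>g\<in>N. \<forall>m\<in>E. g m = f m"
  using assms
proof (induction E arbitrary: N f rule: finite_linorder_max_induct)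
  case empty
  then show ?case by blast
next
  case (insert b A)
  note add = insert.prems(1) and scale = insert.prems(2)
  \<comment> \<open>The nonunits form an ideal, so \<open>N'\<close> inherits the closure
    properties. It also keeps the elements required for each \<open>m\<close> in \<open>A\<close>,
    since these are nonunits at \<open>b > m\<close>.\<close>
  define N' where "N' = {g \<in> N. \<not> g b dvd 1}"
  have approx: "\<exists>g\<in>N'. \<forall>m\<in>A. g m = u m" for u
  proof (rule insert.IH)
    show "(\<lambda>k. g k + h k) \<in> N'" if "g \<in> N'" "h \<in> N'" for g h
      using that add unfolding N'_def by (auto dest: nonunit_add)
    show "(\<lambda>k. c * g k) \<in> N'" if "g \<in> N'" for c g
      using that scale unfolding N'_def by (auto dest: dvd_mult_right)
    show "(\<lambda>k. 0) \<in> N'"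
      using insert.prems(3) unfolding N'_def by auto
    show "\<exists>h\<in>N'. h m dvd 1 \<and> (\<forall>m'>m. \<not> h m' dvd 1)" if m: "m \<in> A" for m
    proof -
      from insert.prems(4)[of m] m obtain h
        where "h \<in> N" "h m dvd 1" "\<forall>m'>m. \<not> h m' dvd 1" by auto
      moreover have "m < b" using insert.hyps m by blast
      ultimately show ?thesis unfolding N'_def by blast
    qed
  qed
  obtain h where h: "h \<in> N" "h b dvd 1"
    using insert.prems(4)[of b] by blast
  obtain u where u: "u \<in> N" "\<not> u b dvd 1" "\<forall>m\<in>A. u m = h m"
    using approx[of h] unfolding N'_def by blast
  obtain v where v: "v \<in> N" "\<forall>m\<in>A. v m = f m"
    using approx[of f] unfolding N'_def by blast
  have "(h b - u b) dvd 1"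
    using h u unit_diff_nonunit by blast
  then obtain w where w: "1 = (h b - u b) * w" by (rule dvdE)
  define c where "c = w * (f b - v b)"
  \<comment> \<open>\<open>h - u\<close> vanishes on \<open>A\<close> and is a unit at
    \<open>b\<close>, so a multiple of it corrects \<open>v\<close> at \<open>b\<close> without
    disturbing \<open>A\<close>.\<close>
  define g where "g = (\<lambda>k. v k + c * (h k + (- 1) * u k))"
  have "g \<in> N"
    unfolding g_def by (intro add scale h u v)
  moreover have "g m = f m" if "m \<in> A" for m
    using that u v by (simp add: g_def)
  moreover have "g b = f b"
  proof -
    have "g b = v b + ((h b - u b) * w) * (f b - v b)"
      by (simp add: g_def c_def algebra_simps)
    then show ?thesis by (simp flip: w)
  qed
  ultimately show ?case by blast
qed

section \<open>Dickson's lemma\<close>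

text \<open>A pair not above a fixed \<open>(k0, j0)\<close> lies on one of finitely many lines
  \<open>k < k0\<close> or \<open>j < j0\<close>, and each line that meets \<open>A\<close> has a
  least element there.\<close>

lemma dickson_pairs:
  fixes A :: "(nat \<times> nat) set"
  shows "\<exists>F\<subseteq>A. finite F \<and> (\<forall>(k, j)\<in>A. \<exists>(k', j')\<in>F. k' \<le> k \<and> j' \<le> j)"
proof (cases "A = {}")
  case False
  then obtain k0 j0 where 0: "(k0, j0) \<in> A" by auto
  define row where "row k = (k, LEAST j. (k, j) \<in> A)" for k
  define col where "col j = (LEAST k. (k, j) \<in> A, j)" for j
  have row: "row k \<in> A" "snd (row k) \<le> j" if "(k, j) \<in> A" for k j
    using that LeastI[of "\<lambda>j. (k, j) \<in> A"] by (auto simp: row_def intro: Least_le)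
  have col: "col j \<in> A" "fst (col j) \<le> k" if "(k, j) \<in> A" for k j
    using that LeastI[of "\<lambda>k. (k, j) \<in> A"] by (auto simp: col_def intro: Least_le)
  \<comment> \<open>Intersecting with \<open>A\<close> discards the arbitrary \<open>LEAST\<close>
    values of empty lines.\<close>
  define F where "F = A \<inter> ({(k0, j0)} \<union> row ` {..<k0} \<union> col ` {..<j0})"
  have "\<exists>(k', j')\<in>F. k' \<le> k \<and> j' \<le> j" if kj: "(k, j) \<in> A" for k j
  proof -
    consider "k0 \<le> k" "j0 \<le> j" | "k < k0" | "j < j0" by linarith
    then show ?thesis
    proof cases
      case 1
      with 0 show ?thesis unfolding F_def by blast
    next
      case 2
      then have "row k \<in> F" using row[OF kj] by (auto simp: F_def)
      then show ?thesis using row[OF kj] by (intro bexI[of _ "row k"]) (auto simp: row_def)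
    next
      case 3
      then have "col j \<in> F" using col[OF kj] by (auto simp: F_def)
      then show ?thesis using col[OF kj] by (intro bexI[of _ "col j"]) (auto simp: col_def)
    qed
  qed
  then show ?thesis
    by (intro exI[of _ F]) (auto simp: F_def)
qed auto

text \<open>Multiplication by \<open>X\<close> moves positions by \<open>n\<close>, so first
  coordinates are comparable only within a residue class; each class is treated separately.\<close>

lemma dickson_pairs_mod:
  fixes A :: "(nat \<times> nat) set" and n :: nat
  assumes "n > 0"
  shows "\<exists>F\<subseteq>A. finite F \<and>
    (\<forall>(k, j)\<in>A. \<exists>(k', j')\<in>F. (\<exists>a. k = k' + a * n) \<and> j' \<le> j)"
proof -
  define B where "B r = {(k, j) \<in> A. k mod n = r}" for r
  have "\<forall>r. \<exists>F. F \<subseteq> B r \<and> finite F \<and> (\<forall>(k, j)\<in>B r. \<exists>(k', j')\<in>F. k' \<le> k \<and> j' \<le> j)"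
    using dickson_pairs by blast
  from choice[OF this] obtain F where "\<forall>r. F r \<subseteq> B r \<and> finite (F r) \<and>
      (\<forall>(k, j)\<in>B r. \<exists>(k', j')\<in>F r. k' \<le> k \<and> j' \<le> j)"
    by (rule exE)
  then have F: "\<And>r. F r \<subseteq> B r" "\<And>r. finite (F r)"
    "\<And>r. \<forall>(k, j)\<in>B r. \<exists>(k', j')\<in>F r. k' \<le> k \<and> j' \<le> j"
    by simp_all
  have "\<exists>(k', j')\<in>(\<Union>r<n. F r). (\<exists>a. k = k' + a * n) \<and> j' \<le> j" if kj: "(k, j) \<in> A" for k j
  proof -
    have "(k, j) \<in> B (k mod n)" using kj by (simp add: B_def)
    then obtain k' j' where *: "(k', j') \<in> F (k mod n)" "k' \<le> k" "j' \<le> j"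
      using F(3) by blast
    then have "k' mod n = k mod n" using F(1)[of "k mod n"] by (auto simp: B_def)
    then have "n dvd k - k'" using \<open>k' \<le> k\<close> by (metis mod_eq_dvd_iff_nat)
    then obtain a where "k - k' = n * a" by (rule dvdE)
    then have "k = k' + a * n" using \<open>k' \<le> k\<close> by (simp add: mult.commute)
    then show ?thesis using * assms by (intro bexI[of _ "(k', j')"]) auto
  qed
  then show ?thesis
    using F(1,2) by (intro exI[of _ "\<Union>r<n. F r"]) (fastforce simp: B_def)
qed

section \<open>The coefficient sequence of a vector of polynomials\<close>

definition idx :: "nat \<Rightarrow> 'n::finite" where
  "idx = (SOME h. bij_betw h {0..<CARD('n)} UNIV)"

lemma bij_betw_idx: "bij_betw (idx :: nat \<Rightarrow> 'n::finite) {0..<CARD('n)} UNIV"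
  unfolding idx_def using someI_ex[OF ex_bij_betw_nat_finite[of "UNIV :: 'n set"]] by simp

text \<open>The monomial \<open>X\<^sup>e\<close> in component \<open>idx i\<close> has position \<open>e * CARD('n) + i\<close>.\<close>

definition vcoeff :: "'a::comm_ring_1 poly ^ 'n \<Rightarrow> nat \<Rightarrow> 'a" where
  "vcoeff f k = coeff (f $ idx (k mod CARD('n))) (k div CARD('n))"

lemma vcoeff_zero [simp]: "vcoeff 0 k = 0"
  by (simp add: vcoeff_def)

lemma vcoeff_add [simp]: "vcoeff (f + g) k = vcoeff f k + vcoeff g k"
  by (simp add: vcoeff_def)

lemma vcoeff_diff [simp]: "vcoeff (f - g) k = vcoeff f k - vcoeff g k"
  by (simp add: vcoeff_def)

lemma vcoeff_const_mult [simp]: "vcoeff ([:a:] *s f) k = a * vcoeff f k"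
  by (simp add: vcoeff_def)

lemma vcoeff_shift [simp]:
  "vcoeff (monom 1 a *s f) (k + a * CARD('n)) = vcoeff (f :: 'a::comm_ring_1 poly ^ 'n) k"
  by (simp add: vcoeff_def coeff_monom_mult)

lemma coeff_eq_vcoeff:
  fixes i :: "'n::finite"
  obtains r where "\<And>(f :: 'a::comm_ring_1 poly ^ 'n) e. coeff (f $ i) e = vcoeff f (e * CARD('n) + r)"
proof -
  obtain r where "r < CARD('n)" "i = idx r"
    using bij_betw_idx[where 'n='n] by (metis UNIV_I atLeastLessThan_iff bij_betw_def imageE)
  then have "coeff (f $ i) e = vcoeff f (e * CARD('n) + r)" for f :: "'a poly ^ 'n" and e
    by (simp add: vcoeff_def)
  then show thesis by (rule that)
qed

lemma vec_poly_eqI: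
  fixes f g :: "'a::comm_ring_1 poly ^ 'n"
  assumes "\<And>k. vcoeff f k = vcoeff g k"
  shows "f = g"
proof -
  have "coeff (f $ i) e = coeff (g $ i) e" for i e
    using coeff_eq_vcoeff[of i] assms by metis
  then show ?thesis by (simp add: vec_eq_iff poly_eq_iff)
qed

lemma vcoeff_eventually_zero:
  fixes f :: "'a::comm_ring_1 poly ^ 'n"
  obtains D where "\<And>k. D \<le> k \<Longrightarrow> vcoeff f k = 0"
proof
  define d where "d = Max (range (\<lambda>i. degree (f $ i)))"
  fix k assume "Suc d * CARD('n) \<le> k"
  then have "d < k div CARD('n)"
    by (simp add: less_eq_div_iff_mult_less_eq flip: Suc_le_eq)
  moreover have "degree (f $ i) \<le> d" for i
    unfolding d_def by (rule Max_ge) auto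
  ultimately show "vcoeff f k = 0"
    unfolding vcoeff_def by (meson coeff_eq_0 le_less_trans)
qed

lemma vec_poly_const_dvd:
  fixes f :: "'a::idom poly ^ 'n"
  assumes "\<And>k. c dvd vcoeff f k"
  obtains g where "f = [:c:] *s g"
proof -
  have "c dvd coeff (f $ i) e" for i e
    using coeff_eq_vcoeff[of i] assms by metis
  then have "\<forall>i. [:c:] dvd f $ i"
    by (simp add: const_poly_dvd_iff)
  then have "\<forall>i. \<exists>p. f $ i = [:c:] * p"
    by (simp add: dvd_def)
  then obtain p where "\<And>i. f $ i = [:c:] * p i" by metis
  then have "f = [:c:] *s (\<chi> i. p i)" by (simp add: vec_eq_iff)
  then show thesis by (rule that)
qed

text \<open>Among the finitely many coefficients up to \<open>D\<close>, one divides all others.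
  Dividing by it turns it into 1, and unit positions stay bounded by \<open>D\<close>.\<close>

lemma vec_poly_primitive_part:
  fixes f :: "'a::valuation_domain poly ^ 'n"
  assumes "f \<noteq> 0"
  obtains c g k where "c \<noteq> 0" "f = [:c:] *s g" "vcoeff g k dvd 1" "\<forall>k'>k. \<not> vcoeff g k' dvd 1"
proof -
  obtain D where D: "\<And>k. D \<le> k \<Longrightarrow> vcoeff f k = 0"
    using vcoeff_eventually_zero by blast
  have "vcoeff f ` {..D} \<noteq> {}" by simp
  then obtain k0 where k0: "\<forall>k\<le>D. vcoeff f k0 dvd vcoeff f k"
    using finite_set_has_divisor[of "vcoeff f ` {..D}"] by auto
  define c where "c = vcoeff f k0"
  have dvd: "c dvd vcoeff f k" for k
    using D[of k] k0 unfolding c_def by (cases "k \<le> D") auto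
  then obtain g where g: "f = [:c:] *s g"
    using vec_poly_const_dvd by blast
  have "c \<noteq> 0"
    using \<open>f \<noteq> 0\<close> g vec_poly_eqI[of f 0] by auto
  have "c * vcoeff g k0 = c"
    using c_def g by (metis vcoeff_const_mult)
  with \<open>c \<noteq> 0\<close> have "vcoeff g k0 dvd 1" by simp
  moreover have bounded: "k \<le> D" if "vcoeff g k dvd 1" for k
  proof (rule ccontr)
    assume "\<not> k \<le> D"
    then have "c * vcoeff g k = 0" using D[of k] g by simp
    with \<open>c \<noteq> 0\<close> that show False by simp
  qed
  ultimately obtain k where "vcoeff g k dvd 1" "\<forall>k'. vcoeff g k' dvd 1 \<longrightarrow> k' \<le> k"
    using Nat.ex_has_greatest_nat[of "\<lambda>k. vcoeff g k dvd 1" k0 D] by auto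
  with g \<open>c \<noteq> 0\<close> show thesis by (intro that[of c g k]) (auto simp: not_le)
qed

section \<open>Saturated submodules\<close>

interpretation vec: module "(*s) :: 'r::comm_ring_1 \<Rightarrow> 'r ^ 'n \<Rightarrow> 'r ^ 'n"
  by (rule module_vector_scalar_mult)

lemma subspace_saturation:
  fixes M :: "('a::idom poly ^ 'n) set"
  assumes "vec.subspace M"
  shows "vec.subspace (saturation M)"
proof (rule vec.subspaceI)
  show "0 \<in> saturation M"
    using vec.subspace_0[OF assms] by (auto simp: saturation_def intro: exI[of _ 1])
next
  fix x y assume "x \<in> saturation M" "y \<in> saturation M"
  then obtain a b where ab: "a \<noteq> 0" "b \<noteq> 0" "[:a:] *s x \<in> M" "[:b:] *s y \<in> M"
    by (auto simp: saturation_def)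
  then have "[:b:] *s ([:a:] *s x) + [:a:] *s ([:b:] *s y) \<in> M"
    using assms by (blast intro: vec.subspace_add vec.subspace_scale)
  also have "[:b:] *s ([:a:] *s x) + [:a:] *s ([:b:] *s y) = [:a * b:] *s (x + y)"
    by (simp add: vec_eq_iff smult_add_right mult.commute)
  finally show "x + y \<in> saturation M"
    using ab by (auto simp: saturation_def intro!: exI[of _ "a * b"])
next
  fix p x assume "x \<in> saturation M"
  then obtain a where a: "a \<noteq> 0" "[:a:] *s x \<in> M"
    by (auto simp: saturation_def)
  then have "p *s ([:a:] *s x) \<in> M"
    using assms by (blast intro: vec.subspace_scale)
  also have "p *s ([:a:] *s x) = [:a:] *s (p *s x)"
    by (simp add: vec_eq_iff)
  finally show "p *s x \<in> saturation M"
    using a by (auto simp: saturation_def)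
qed

lemma saturation_cancel:
  fixes M :: "('a::idom poly ^ 'n) set"
  assumes "[:c:] *s x \<in> saturation M" "c \<noteq> 0"
  shows "x \<in> saturation M"
proof -
  from assms obtain a where "a \<noteq> 0" "[:a:] *s ([:c:] *s x) \<in> M"
    by (auto simp: saturation_def)
  moreover have "[:a:] *s ([:c:] *s x) = [:a * c:] *s x"
    by (simp add: vec_eq_iff mult.commute)
  ultimately show ?thesis
    using assms by (auto simp: saturation_def intro!: exI[of _ "a * c"])
qed

text \<open>The bound \<open>D\<close> is recorded separately because coefficients after
  \<open>k\<close> are only nonunits, not zero.\<close>

definition leads_at :: "'a::comm_ring_1 poly ^ 'n \<Rightarrow> nat \<Rightarrow> nat \<Rightarrow> bool" where
  "leads_at f k D \<longleftrightarrow> vcoeff f k dvd 1 \<and> (\<forall>k'>k. \<not> vcoeff f k' dvd 1) \<and> (\<forall>k'\<ge>D. vcoeff f k' = 0)"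

lemma leads_at_mono: "leads_at f k D \<Longrightarrow> D \<le> D' \<Longrightarrow> leads_at f k D'"
  by (auto simp: leads_at_def)

lemma leads_at_less: "leads_at f k D \<Longrightarrow> k < D" for f :: "'a::idom poly ^ 'n"
  by (metis leads_at_def not_le dvd_0_left_iff zero_neq_one)

lemma leads_at_shift:
  fixes f :: "'a::comm_ring_1 poly ^ 'n"
  assumes "leads_at f k D"
  shows "leads_at (monom 1 a *s f) (k + a * CARD('n)) (D + a * CARD('n))"
proof -
  have *: "vcoeff (monom 1 a *s f) k' = vcoeff f (k' - a * CARD('n))" if "a * CARD('n) \<le> k'" for k'
    using vcoeff_shift[of a f "k' - a * CARD('n)"] that by simp
  show ?thesis
    using assms by (auto simp: leads_at_def *)
qed

lemma saturated_finitely_generated: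
  fixes S :: "('a::valuation_domain poly ^ 'n) set"
  assumes S: "vec.subspace S"
    and saturated: "\<And>c x. [:c:] *s x \<in> S \<Longrightarrow> c \<noteq> 0 \<Longrightarrow> x \<in> S"
  shows "\<exists>G. finite G \<and> S = vec.span G"
proof -
  \<comment> \<open>With the excess \<open>j = D - k\<close> in place of \<open>D\<close>, a shift
    moves only \<open>k\<close> and a larger bound raises only \<open>j\<close>, as the order in
    \<open>dickson_pairs_mod\<close> demands.\<close>
  define A where "A = {(k, j). \<exists>f\<in>S. leads_at f k (k + j)}"
  obtain F where F: "F \<subseteq> A" "finite F"
    "\<forall>(k, j)\<in>A. \<exists>(k', j')\<in>F. (\<exists>a. k = k' + a * CARD('n)) \<and> j' \<le> j"
    using dickson_pairs_mod[of "CARD('n)" A] by auto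
  have "\<forall>z\<in>A. \<exists>f\<in>S. leads_at f (fst z) (fst z + snd z)"
    by (auto simp: A_def)
  then obtain gen where gen: "\<And>z. z \<in> A \<Longrightarrow> gen z \<in> S \<and> leads_at (gen z) (fst z) (fst z + snd z)"
    by metis
  define G where "G = gen ` F"
  have "G \<subseteq> S" using gen F(1) by (auto simp: G_def)
  then have span: "vec.span G \<subseteq> S" using S by (rule vec.span_minimal)
  have lead: "\<exists>h\<in>vec.span G. leads_at h k D" if f: "f \<in> S" "leads_at f k D" for f k D
  proof -
    have "(k, D - k) \<in> A"
      using f leads_at_less[OF f(2)] by (auto simp: A_def)
    then obtain k' j' a where *: "(k', j') \<in> F" "k = k' + a * CARD('n)" "j' \<le> D - k"
      using F(3) by blast
    have "leads_at (gen (k', j')) k' (k' + j')"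
      using gen[of "(k', j')"] * F(1) by auto
    then have "leads_at (monom 1 a *s gen (k', j')) k (k' + j' + a * CARD('n))"
      using leads_at_shift * by blast
    moreover have "k' + j' + a * CARD('n) \<le> D"
      using * leads_at_less[OF f(2)] by linarith
    moreover have "monom 1 a *s gen (k', j') \<in> vec.span G"
      using * by (intro vec.span_scale vec.span_base) (auto simp: G_def)
    ultimately show ?thesis using leads_at_mono by blast
  qed
  have "f \<in> vec.span G" if f: "f \<in> S" for f
  proof -
    obtain D where D: "\<And>k. D \<le> k \<Longrightarrow> vcoeff f k = 0"
      using vcoeff_eventually_zero by blast
    define N where "N = vcoeff ` {h \<in> vec.span G. \<forall>k\<ge>D. vcoeff h k = 0}"
    define E where "E = {k. \<exists>h\<in>S. leads_at h k D}"
    have "\<exists>u\<in>N. \<forall>k\<in>E. u k = vcoeff f k"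
    proof (rule triangular_solve)
      have "E \<subseteq> {..<D}" using leads_at_less by (auto simp: E_def)
      then show "finite E" by (rule finite_subset) simp
      show "(\<lambda>k. u k + v k) \<in> N" if uv: "u \<in> N" "v \<in> N" for u v
      proof -
        obtain g h where "u = vcoeff g" "v = vcoeff h" "g \<in> vec.span G" "h \<in> vec.span G"
          "\<forall>k\<ge>D. vcoeff g k = 0" "\<forall>k\<ge>D. vcoeff h k = 0"
          using uv by (auto simp: N_def)
        then show ?thesis
          unfolding N_def by (intro image_eqI[of _ _ "g + h"]) (auto intro: vec.span_add)
      qed
      show "(\<lambda>k. c * u k) \<in> N" if u: "u \<in> N" for c u
      proof -
        obtain g where "u = vcoeff g" "g \<in> vec.span G" "\<forall>k\<ge>D. vcoeff g k = 0"
          using u by (auto simp: N_def)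
        then show ?thesis
          unfolding N_def by (intro image_eqI[of _ _ "[:c:] *s g"]) (auto intro: vec.span_scale)
      qed
      show "(\<lambda>k. 0) \<in> N"
        unfolding N_def by (intro image_eqI[of _ _ 0]) (auto intro: vec.span_zero)
      show "\<exists>u\<in>N. u k dvd 1 \<and> (\<forall>k'>k. \<not> u k' dvd 1)" if k: "k \<in> E" for k
      proof -
        obtain h where "h \<in> vec.span G" "leads_at h k D"
          using k lead unfolding E_def by blast
        then show ?thesis
          unfolding N_def leads_at_def by (intro bexI[of _ "vcoeff h"]) auto
      qed
    qed
    then obtain g where g: "g \<in> vec.span G" "\<forall>k\<ge>D. vcoeff g k = 0" "\<forall>k\<in>E. vcoeff g k = vcoeff f k"
      by (auto simp: N_def)
    have "f - g = 0"
    proof (rule ccontr)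
      assume "f - g \<noteq> 0"
      then obtain c h k where h: "c \<noteq> 0" "f - g = [:c:] *s h" "vcoeff h k dvd 1"
        "\<forall>k'>k. \<not> vcoeff h k' dvd 1"
        by (rule vec_poly_primitive_part)
      have ch: "c * vcoeff h m = vcoeff f m - vcoeff g m" for m
        using h(2) by (metis vcoeff_diff vcoeff_const_mult)
      have "f - g \<in> S" using f g(1) span S by (auto intro: vec.subspace_diff)
      \<comment> \<open>Saturation cancels the content \<open>c\<close> inside \<open>S\<close>; as
        \<open>c\<close> is not a zero divisor, \<open>h\<close> keeps the bound \<open>D\<close>,
        which puts \<open>k\<close> into \<open>E\<close>.\<close>
      then have "h \<in> S" using saturated h by metis
      moreover have "vcoeff h m = 0" if "D \<le> m" for m
        using ch[of m] D[OF that] g(2) that h(1) by simp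
      ultimately have "k \<in> E" using h by (auto simp: E_def leads_at_def)
      then have "vcoeff h k = 0" using ch[of k] g(3) h(1) by simp
      with h(3) show False by simp
    qed
    with g show ?thesis by simp
  qed
  with span have "S = vec.span G" by blast
  moreover have "finite G" using F(2) by (simp add: G_def)
  ultimately show ?thesis by blast
qed

theorem theorem2p1:
  fixes M :: "('a::valuation_domain poly ^ 'n) set"
  assumes "fin_gen_submodule (*s) M"
  shows "fin_gen_submodule (*s) (saturation M)"
proof -
  have "vec.subspace (saturation M)"
    using assms by (intro subspace_saturation) (simp add: fin_gen_submodule_def)
  moreover from this have "\<exists>G. finite G \<and> saturation M = vec.span G"
    by (rule saturated_finitely_generated) (rule saturation_cancel)
  ultimately show ?thesis
    by (simp add: fin_gen_submodule_def)
qed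

end
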